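(* A $(t,s,v)$-AONT is equivalent to a $(v^s,2s,v)$-array that is unbiased with respect to the following subsets of columns: (1) $\{1,\dots,s\}$; (2) $\{s+1,\dots,2s\}$; and (3) $I\cup(\{s+1,\dots,2s\}\setminus J)$, for all $I\subseteq\{1,\dots,s\}$ with $|I|=t$ and all $J\subseteq\{s+1,\dots,2s\}$ with $|J|=t$.
   Context: Let $1\le t\le s$ and let $X$ be a finite set (alphabet) with $|X|=v$. A function $\phi:X^s\to X^s$, mapping an input $s$-tuple $(x_1,\dots,x_s)$ to an output $s$-tuple $(y_1,\dots,y_s)$, is a $(t,s,v)$-AONT ($t$-all-or-nothing transform) if (1) $\phi$ is a bijection, and (2) if any $s-t$ of the $s$ output values $y_1,\dots,y_s$ are fixed, then any $t$ of the input values $x_i$ ($1\le i\le s$) are completely undetermined, in an information-theoretic sense (that is, these $t$ inputs take on all values in $X^t$ as the remaining $t$ outputs vary over $X^t$). An $(N,k,v)$-array is an $N\times k$ array $A$ whose entries are elements of an alphabet $X$ of order $v$, with columns labelled $1,\dots,k$. For $D\subseteq\{1,\dots,k\}$, $A_D$ is the array obtained from $A$ by deleting all the columns $c\notin D$; $A$ is unbiased with respect to $D$ if the rows of $A_D$ contain every $|D|$-tuple of elements of $X$ exactly $N/v^{|D|}$ times. *)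

theory Defs
  imports Complex_Main "HOL-Library.FuncSet"
begin

text \<open>A tuple indexed by a set \<open>D\<close> of positions is an extensional function on \<open>D\<close>, so that
  \<open>X\<^sup>s\<close> is \<open>tuples {1..s} X\<close> and the projection of a tuple to \<open>D\<close> is \<open>restrict _ D\<close>.\<close>

abbreviation tuples :: "nat set \<Rightarrow> 'a set \<Rightarrow> (nat \<Rightarrow> 'a) set" where
  "tuples D X \<equiv> D \<rightarrow>\<^sub>E X"

text \<open>\<open>K\<close> is the set of the \<open>s - t\<close> output positions that are fixed, to the values \<open>b\<close>, and \<open>I\<close>
  is the set of the \<open>t\<close> input positions that have to remain undetermined.\<close>

definition aont :: "nat \<Rightarrow> nat \<Rightarrow> nat \<Rightarrow> 'a set \<Rightarrow> ((nat \<Rightarrow> 'a) \<Rightarrow> (nat \<Rightarrow> 'a)) \<Rightarrow> bool" where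
  "aont t s v X \<phi> \<longleftrightarrow>
     1 \<le> t \<and> t \<le> s \<and> finite X \<and> card X = v \<and>
     bij_betw \<phi> (tuples {1..s} X) (tuples {1..s} X) \<and>
     (\<forall>K I. K \<subseteq> {1..s} \<and> card K = s - t \<and> I \<subseteq> {1..s} \<and> card I = t \<longrightarrow>
        (\<forall>b \<in> tuples K X.
           (\<lambda>y. restrict (inv_into (tuples {1..s} X) \<phi> y) I) `
             {y \<in> tuples {1..s} X. restrict y K = b} = tuples I X))"

text \<open>The entry in row \<open>r\<close> and column \<open>c\<close> is \<open>A r c\<close>; rows and columns are numbered from 1, and
  values of \<open>A\<close> outside this range are irrelevant.\<close>

definition is_array :: "nat \<Rightarrow> nat \<Rightarrow> nat \<Rightarrow> 'a set \<Rightarrow> (nat \<Rightarrow> nat \<Rightarrow> 'a) \<Rightarrow> bool" where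
  "is_array N k v X A \<longleftrightarrow>
     finite X \<and> card X = v \<and> (\<forall>r \<in> {1..N}. \<forall>c \<in> {1..k}. A r c \<in> X)"

text \<open>The quotient is taken in the reals, so that it is not rounded.\<close>

definition unbiased :: "nat \<Rightarrow> nat \<Rightarrow> 'a set \<Rightarrow> (nat \<Rightarrow> nat \<Rightarrow> 'a) \<Rightarrow> nat set \<Rightarrow> bool" where
  "unbiased N v X A D \<longleftrightarrow>
     (\<forall>d \<in> tuples D X.
        real (card {r \<in> {1..N}. restrict (A r) D = d}) = real N / real v ^ card D)"

definition aont_array :: "nat \<Rightarrow> nat \<Rightarrow> nat \<Rightarrow> 'a set \<Rightarrow> (nat \<Rightarrow> nat \<Rightarrow> 'a) \<Rightarrow> bool" where
  "aont_array t s v X A \<longleftrightarrow>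
     is_array (v ^ s) (2 * s) v X A \<and>
     unbiased (v ^ s) v X A {1..s} \<and>
     unbiased (v ^ s) v X A {s+1..2*s} \<and>
     (\<forall>I J. I \<subseteq> {1..s} \<and> card I = t \<and> J \<subseteq> {s+1..2*s} \<and> card J = t \<longrightarrow>
        unbiased (v ^ s) v X A (I \<union> ({s+1..2*s} - J)))"

text \<open>The rows of \<open>A\<close> are the concatenations of \<open>x\<close> and \<open>\<phi> x\<close>, each \<open>x\<close> in \<open>X\<^sup>s\<close> occurring in
  exactly one row, in any order of the rows.\<close>

definition lists_graph ::
  "nat \<Rightarrow> nat \<Rightarrow> 'a set \<Rightarrow> (nat \<Rightarrow> nat \<Rightarrow> 'a) \<Rightarrow> ((nat \<Rightarrow> 'a) \<Rightarrow> (nat \<Rightarrow> 'a)) \<Rightarrow> bool" where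
  "lists_graph s v X A \<phi> \<longleftrightarrow>
     bij_betw (\<lambda>r. restrict (A r) {1..s}) {1..v ^ s} (tuples {1..s} X) \<and>
     (\<forall>r \<in> {1..v ^ s}. \<forall>i \<in> {1..s}. A r (s + i) = \<phi> (restrict (A r) {1..s}) i)"

end

theory Submission
  imports Defs
begin

text \<open>All column sets \<open>D\<close> in question have exactly \<open>s\<close> elements, so that there are as many
  rows as \<open>D\<close>-tuples; hence unbiasedness with respect to \<open>D\<close> just says that every \<open>D\<close>-tuple
  occurs in some row. When the rows are the pairs \<open>(x, \<phi> x)\<close>, this surjectivity for the inputs
  \<open>I\<close> and the outputs \<open>K\<close> is the all-or-nothing condition for \<open>I\<close> and \<open>K\<close>, and for the set of
  all outputs it is the bijectivity of \<open>\<phi>\<close>.\<close>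

section \<open>Bijectivity by fibres and by covering\<close>

lemma bij_betw_iff_card_fibres:
  assumes "f \<in> R \<rightarrow> T"
  shows "bij_betw f R T \<longleftrightarrow> (\<forall>d\<in>T. card {r \<in> R. f r = d} = 1)"
proof
  assume bij: "bij_betw f R T"
  show "\<forall>d\<in>T. card {r \<in> R. f r = d} = 1"
  proof
    fix d assume "d \<in> T"
    then obtain r where "r \<in> R" "f r = d"
      using bij unfolding bij_betw_def by blast
    then have "{r \<in> R. f r = d} = {r}"
      using bij unfolding bij_betw_def inj_on_def by blast
    then show "card {r \<in> R. f r = d} = 1" by simp
  qed
next
  assume one: "\<forall>d\<in>T. card {r \<in> R. f r = d} = 1"
  have "r = r'" if "r \<in> R" "r' \<in> R" "f r = f r'" for r r'
  proof -
    have "f r' \<in> T" using assms that(2) by blast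
    then obtain q where q: "{r \<in> R. f r = f r'} = {q}"
      using one card_1_singletonE by metis
    have "r \<in> {q}" "r' \<in> {q}"
      unfolding q[symmetric] using that by simp_all
    then show ?thesis by simp
  qed
  moreover have "d \<in> f ` R" if d: "d \<in> T" for d
  proof -
    have "{r \<in> R. f r = d} \<noteq> {}"
      using one d by (metis card.empty zero_neq_one)
    then show ?thesis by blast
  qed
  ultimately show "bij_betw f R T"
    using assms unfolding bij_betw_def inj_on_def by blast
qed

lemma image_eq_iff_covers:
  assumes "f ` S \<subseteq> T"
  shows "f ` S = T \<longleftrightarrow> (\<forall>d\<in>T. \<exists>x\<in>S. f x = d)"
  using assms by (auto simp: set_eq_subset subset_iff image_iff eq_commute)

text \<open>A surjection of a finite set onto itself is injective.\<close>

lemma bij_betw_iff_covers: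
  assumes "finite T" "f \<in> T \<rightarrow> T"
  shows "bij_betw f T T \<longleftrightarrow> (\<forall>d\<in>T. \<exists>x\<in>T. f x = d)"
proof -
  have "f ` T \<subseteq> T" using assms(2) by blast
  then have "(\<forall>d\<in>T. \<exists>x\<in>T. f x = d) \<longleftrightarrow> f ` T = T"
    by (rule image_eq_iff_covers[symmetric])
  moreover have "inj_on f T" if "f ` T = T"
    using that assms(1) by (simp add: eq_card_imp_inj_on)
  ultimately show ?thesis unfolding bij_betw_def by blast
qed

lemma card_tuples:
  assumes "finite D"
  shows "card (tuples D X) = card X ^ card D"
  using assms by (simp add: card_PiE)

section \<open>Unbiasedness with respect to \<open>s\<close> columns\<close>

text \<open>Because \<open>card D = s\<close>, the prescribed frequency is
  \<open>v ^ s / v ^ s\<close>, which is 1 unless \<open>v ^ s = 0\<close>; every fibre of the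
  projection to \<open>D\<close> is then a singleton.\<close>

lemma unbiased_iff_bij_betw:
  assumes "is_array (v ^ s) k v X A" "D \<subseteq> {1..k}" "card D = s"
  shows "unbiased (v ^ s) v X A D \<longleftrightarrow>
    bij_betw (\<lambda>r. restrict (A r) D) {1..v ^ s} (tuples D X)"
proof -
  have fin: "finite D" "finite X" "card X = v"
    using assms finite_subset unfolding is_array_def by auto
  have rows: "(\<lambda>r. restrict (A r) D) \<in> {1..v ^ s} \<rightarrow> tuples D X"
    using assms(1,2) unfolding is_array_def by (auto simp: subset_iff)
  show ?thesis
  \<comment> \<open>Without \<open>D\<close>-tuples the quotient is not 1, but then there are no
    rows either, and both sides hold trivially.\<close>
  proof (cases "tuples D X = {}")
    case True
    then have "v ^ s = 0"
      using card_tuples[OF fin(1), of X] fin(3) assms(3) by simp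
    with True show ?thesis
      unfolding unbiased_def by (auto simp: bij_betw_def)
  next
    case False
    then have "v ^ s \<noteq> 0"
      using card_tuples[OF fin(1), of X] fin assms(3) finite_PiE[of D "\<lambda>_. X"]
      by (metis card_0_eq)
    then have "real (v ^ s) / real v ^ card D = 1"
      using assms(3) by simp
    then show ?thesis
      unfolding bij_betw_iff_card_fibres[OF rows] unbiased_def by (simp only: of_nat_eq_1_iff)
  qed
qed

text \<open>The projection goes from \<open>v ^ s\<close> rows to \<open>v ^ s\<close> tuples, so it
  is injective as soon as it is onto.\<close>

lemma unbiased_iff_covers:
  assumes "is_array (v ^ s) k v X A" "D \<subseteq> {1..k}" "card D = s"
  shows "unbiased (v ^ s) v X A D \<longleftrightarrow>
    (\<forall>d \<in> tuples D X. \<exists>r \<in> {1..v ^ s}. restrict (A r) D = d)" (is "_ \<longleftrightarrow> ?cov")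
proof -
  have fin: "finite D" "finite X" "card X = v"
    using assms finite_subset unfolding is_array_def by auto
  have rows: "(\<lambda>r. restrict (A r) D) ` {1..v ^ s} \<subseteq> tuples D X"
    using assms(1,2) unfolding is_array_def by (auto simp: subset_iff)
  let ?f = "\<lambda>r. restrict (A r) D"
  have "card (?f ` {1..v ^ s}) = card {1..v ^ s}" if "?f ` {1..v ^ s} = tuples D X"
    unfolding that using card_tuples[OF fin(1), of X] fin(3) assms(3) by simp
  then have "bij_betw ?f {1..v ^ s} (tuples D X) \<longleftrightarrow> ?f ` {1..v ^ s} = tuples D X"
    unfolding bij_betw_def using eq_card_imp_inj_on[OF finite_atLeastAtMost] by blast
  then show ?thesis
    unfolding unbiased_iff_bij_betw[OF assms] image_eq_iff_covers[OF rows] .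
qed

section \<open>Arrays whose rows form the graph of a map\<close>

lemma restrict_eq_iff: "restrict f D = restrict g D \<longleftrightarrow> (\<forall>c\<in>D. f c = g c)"
  by (auto simp: restrict_def fun_eq_iff)

text \<open>Output position \<open>k\<close> sits in column \<open>s + k\<close>, so a tuple on
  these \<open>s\<close> columns amounts to a pair of an \<open>I\<close>-tuple of inputs and a
  \<open>K\<close>-tuple of outputs, and the rows run through all inputs \<open>x\<close>. The lemma
  serves the mixed column sets and, with \<open>I\<close> empty, the set of all output
  columns.\<close>

lemma unbiased_graph_iff:
  assumes arr: "is_array (v ^ s) (2 * s) v X A" and graph: "lists_graph s v X A \<phi>"
    and I: "I \<subseteq> {1..s}" and K: "K \<subseteq> {1..s}" and card: "card I + card K = s"
  shows "unbiased (v ^ s) v X A (I \<union> (+) s ` K) \<longleftrightarrow>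
    (\<forall>a \<in> tuples I X. \<forall>b \<in> tuples K X.
       \<exists>x \<in> tuples {1..s} X. restrict x I = a \<and> restrict (\<phi> x) K = b)" (is "_ \<longleftrightarrow> ?pairs")
proof -
  let ?D = "I \<union> (+) s ` K" and ?x = "\<lambda>r. restrict (A r) {1..s}"
  have fin: "finite I" "finite K" using I K finite_subset by blast+
  have disj: "i \<noteq> s + k" if "i \<in> I" "k \<in> K" for i k
  proof -
    have "i \<le> s" "1 \<le> k" using that I K by auto
    then show ?thesis by simp
  qed
  then have "card ?D = s"
    using card fin by (subst card_Un_disjoint) (auto simp: card_image)
  moreover have "?D \<subseteq> {1..2 * s}" using I K by fastforce
  ultimately have cov: "unbiased (v ^ s) v X A ?D \<longleftrightarrow>
      (\<forall>d \<in> tuples ?D X. \<exists>r \<in> {1..v ^ s}. restrict (A r) ?D = d)"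
    using unbiased_iff_covers[OF arr] by blast
  have inputs: "?x ` {1..v ^ s} = tuples {1..s} X"
    using graph by (auto simp: lists_graph_def bij_betw_def)
  have outputs: "A r (s + k) = \<phi> (?x r) k" if "r \<in> {1..v ^ s}" "k \<in> K" for r k
    using graph that K by (auto simp: lists_graph_def)
  \<comment> \<open>Agreement of a row with \<open>d\<close> splits into an input half and an output
    half.\<close>
  have row: "restrict (A r) ?D = d \<longleftrightarrow>
      restrict (?x r) I = restrict d I \<and> restrict (\<phi> (?x r)) K = restrict (\<lambda>k. d (s + k)) K"
    if "d \<in> tuples ?D X" "r \<in> {1..v ^ s}" for d r
  proof -
    have "restrict (A r) ?D = d \<longleftrightarrow> (\<forall>c\<in>?D. A r c = d c)"
      using that(1) by (auto simp: fun_eq_iff PiE_def extensional_def restrict_def)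
    also have "\<dots> \<longleftrightarrow> (\<forall>i\<in>I. ?x r i = d i) \<and> (\<forall>k\<in>K. \<phi> (?x r) k = d (s + k))"
      using I outputs[OF that(2)] by (auto simp: subset_iff)
    also have "\<dots> \<longleftrightarrow> restrict (?x r) I = restrict d I
        \<and> restrict (\<phi> (?x r)) K = restrict (\<lambda>k. d (s + k)) K"
      by (simp only: restrict_eq_iff)
    finally show ?thesis .
  qed
  show ?thesis unfolding cov
  proof
    assume covers: "\<forall>d \<in> tuples ?D X. \<exists>r \<in> {1..v ^ s}. restrict (A r) ?D = d"
    show ?pairs
    proof (intro ballI)
      fix a b assume a: "a \<in> tuples I X" and b: "b \<in> tuples K X"
      \<comment> \<open>\<open>d\<close> glues \<open>a\<close> to the shifted \<open>b\<close>; by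
        \<open>disj\<close> no shifted column lies in \<open>I\<close>, so the test
        \<open>c \<in> I\<close> never hides a value of \<open>b\<close>.\<close>
      define d where "d = restrict (\<lambda>c. if c \<in> I then a c else b (c - s)) ?D"
      have d: "d \<in> tuples ?D X" unfolding d_def using a b by auto
      have "restrict d I = a" "restrict (\<lambda>k. d (s + k)) K = b"
        using a b disj by (auto simp: d_def fun_eq_iff PiE_def extensional_def)
      moreover obtain r where r: "r \<in> {1..v ^ s}" "restrict (A r) ?D = d"
        using covers d by blast
      ultimately have "restrict (?x r) I = a \<and> restrict (\<phi> (?x r)) K = b"
        using row[OF d r(1)] by simp
      moreover have "?x r \<in> tuples {1..s} X" using inputs r(1) by blast
      ultimately show "\<exists>x \<in> tuples {1..s} X. restrict x I = a \<and> restrict (\<phi> x) K = b"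
        by blast
    qed
  next
    assume pairs: ?pairs
    show "\<forall>d \<in> tuples ?D X. \<exists>r \<in> {1..v ^ s}. restrict (A r) ?D = d"
    proof
      fix d assume d: "d \<in> tuples ?D X"
      have "restrict d I \<in> tuples I X" "restrict (\<lambda>k. d (s + k)) K \<in> tuples K X"
        using d by auto
      then obtain x where x: "x \<in> tuples {1..s} X" "restrict x I = restrict d I"
        "restrict (\<phi> x) K = restrict (\<lambda>k. d (s + k)) K"
        using pairs by meson
      then obtain r where "r \<in> {1..v ^ s}" "x = ?x r"
        using inputs by blast
      with x row[OF d] show "\<exists>r \<in> {1..v ^ s}. restrict (A r) ?D = d"
        by blast
    qed
  qed
qed

section \<open>The all-or-nothing condition without the inverse\<close>

text \<open>Substituting \<open>y = \<phi> x\<close> cancels the inverse: the inputs behind the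
  fixed outputs \<open>b\<close> are the \<open>x\<close> with
  \<open>restrict (\<phi> x) K = b\<close>. Their projections to \<open>I\<close> always lie in
  \<open>tuples I X\<close>, so equality means that each \<open>a\<close> is attained. This is the
  condition on pairs from \<open>unbiased_graph_iff\<close>.\<close>

lemma undetermined_iff:
  assumes "bij_betw \<phi> (tuples S X) (tuples S X)" "I \<subseteq> S"
  shows "(\<forall>b \<in> tuples K X. (\<lambda>y. restrict (inv_into (tuples S X) \<phi> y) I) `
        {y \<in> tuples S X. restrict y K = b} = tuples I X) \<longleftrightarrow>
    (\<forall>a \<in> tuples I X. \<forall>b \<in> tuples K X.
       \<exists>x \<in> tuples S X. restrict x I = a \<and> restrict (\<phi> x) K = b)"
proof -
  let ?T = "tuples S X"
  have inj: "inj_on \<phi> ?T" and im: "\<phi> ` ?T = ?T"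
    using assms(1) by (auto simp: bij_betw_def)
  have "{y \<in> \<phi> ` ?T. restrict y K = b} = \<phi> ` {x \<in> ?T. restrict (\<phi> x) K = b}" for b
    by blast
  then have "{y \<in> ?T. restrict y K = b} = \<phi> ` {x \<in> ?T. restrict (\<phi> x) K = b}" for b
    unfolding im .
  then have *: "(\<lambda>y. restrict (inv_into ?T \<phi> y) I) ` {y \<in> ?T. restrict y K = b} =
      (\<lambda>x. restrict x I) ` {x \<in> ?T. restrict (\<phi> x) K = b}" for b
    using inj by (simp add: image_image cong: image_cong_simp)
  have image: "(\<lambda>x. restrict x I) ` {x \<in> ?T. restrict (\<phi> x) K = b} \<subseteq> tuples I X" for b
    using assms(2) by auto
  have swap: "(\<forall>b\<in>B. \<forall>a\<in>A. P a b) \<longleftrightarrow> (\<forall>a\<in>A. \<forall>b\<in>B. P a b)"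
    for A :: "'b set" and B :: "'c set" and P
    by blast
  show ?thesis
    unfolding * image_eq_iff_covers[OF image]
    by (subst swap) (simp only: Bex_def mem_Collect_eq conj_ac)
qed

section \<open>Comparing a map with an array listing its graph\<close>

lemma shift_atLeastAtMost: "{s + 1..2 * s} = (+) s ` {1..s}" for s :: nat
  by (simp add: mult_2)

text \<open>The shift by \<open>s\<close> is injective and so commutes with complements. This
  translates the deleted columns \<open>J\<close> of an array into the fixed positions
  \<open>K\<close> of a transform.\<close>

lemma outputs_complement:
  fixes s :: nat
  shows "{s + 1..2 * s} - (+) s ` L = (+) s ` ({1..s} - L)"
  unfolding shift_atLeastAtMost by (simp add: image_set_diff)

text \<open>The definitions match clause by clause: the graph condition gives unbiasedness on the
  inputs, unbiasedness on the outputs is bijectivity of \<open>\<phi>\<close>, and the mixed column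
  sets correspond to the choices of \<open>K\<close> and \<open>I\<close>. Bijectivity is among the
  properties compared, so the lemma serves both directions of the theorem.\<close>

lemma aont_iff_aont_array:
  assumes ts: "1 \<le> t" "t \<le> s" and arr: "is_array (v ^ s) (2 * s) v X A"
    and graph: "lists_graph s v X A \<phi>"
    and \<phi>: "\<phi> \<in> tuples {1..s} X \<rightarrow> tuples {1..s} X"
  shows "aont t s v X \<phi> \<longleftrightarrow> aont_array t s v X A"
proof -
  let ?T = "tuples {1..s} X"
  let ?pairs = "\<lambda>I K. \<forall>a \<in> tuples I X. \<forall>b \<in> tuples K X.
       \<exists>x \<in> ?T. restrict x I = a \<and> restrict (\<phi> x) K = b"
  have X: "finite X" "card X = v" using arr by (auto simp: is_array_def)
  have inputs: "unbiased (v ^ s) v X A {1..s}"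
    using graph unbiased_iff_bij_betw[OF arr, of "{1..s}"] by (simp add: lists_graph_def)
  \<comment> \<open>For \<open>I = {}\<close> the only \<open>a\<close> is the empty tuple, and
    \<open>K = {1..s}\<close> prescribes all of \<open>\<phi> x\<close>; what remains is that
    \<open>\<phi>\<close> is onto, hence bijective by finiteness.\<close>
  have "unbiased (v ^ s) v X A {s+1..2*s} \<longleftrightarrow> ?pairs {} {1..s}"
    using unbiased_graph_iff[OF arr graph, of "{}" "{1..s}"] unfolding shift_atLeastAtMost
    by simp
  also have "\<dots> \<longleftrightarrow> (\<forall>b \<in> ?T. \<exists>x \<in> ?T. \<phi> x = b)"
  proof -
    have "restrict (\<phi> x) {1..s} = \<phi> x" if "x \<in> ?T" for x
      using \<phi> that by (intro PiE_restrict) auto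
    then show ?thesis by (simp add: restrict_def cong: bex_cong)
  qed
  also have "\<dots> \<longleftrightarrow> bij_betw \<phi> ?T ?T"
    using X by (intro bij_betw_iff_covers[OF _ \<phi>, symmetric]) (simp add: finite_PiE)
  finally have outputs: "unbiased (v ^ s) v X A {s+1..2*s} \<longleftrightarrow> bij_betw \<phi> ?T ?T" .
  have mixed_iff: "(\<forall>I J. I \<subseteq> {1..s} \<and> card I = t \<and> J \<subseteq> {s+1..2*s} \<and> card J = t \<longrightarrow>
        unbiased (v ^ s) v X A (I \<union> ({s+1..2*s} - J))) \<longleftrightarrow>
      (\<forall>K I. K \<subseteq> {1..s} \<and> card K = s - t \<and> I \<subseteq> {1..s} \<and> card I = t \<longrightarrow> ?pairs I K)"
    (is "?mixed \<longleftrightarrow> ?allpairs")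
  proof
    assume mixed: ?mixed
    show ?allpairs
    proof (intro allI impI, elim conjE)
      fix K I assume K: "K \<subseteq> {1..s}" "card K = s - t" and I: "I \<subseteq> {1..s}" "card I = t"
      \<comment> \<open>The columns of the outputs that are not fixed; deleting them leaves those of
        \<open>K\<close>.\<close>
      let ?J = "(+) s ` ({1..s} - K)"
      have "card ({1..s} - K) = t"
        using K ts finite_subset[OF K(1)] by (simp add: card_Diff_subset)
      then have "card ?J = t" by (simp add: card_image)
      moreover have "?J \<subseteq> {s+1..2*s}" unfolding shift_atLeastAtMost by blast
      moreover have "{s+1..2*s} - ?J = (+) s ` K"
        using K(1) by (simp only: outputs_complement double_diff[OF K(1) subset_refl])
      ultimately have "unbiased (v ^ s) v X A (I \<union> (+) s ` K)"
        using mixed[rule_format, of I ?J] I by simp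
      moreover have "card I + card K = s" using I(2) K(2) ts by simp
      ultimately show "?pairs I K"
        using unbiased_graph_iff[OF arr graph I(1) K(1)] by (simp only:)
    qed
  next
    assume pairs: ?allpairs
    show ?mixed
    proof (intro allI impI, elim conjE)
      fix I J assume I: "I \<subseteq> {1..s}" "card I = t" and J: "J \<subseteq> {s+1..2*s}" "card J = t"
      \<comment> \<open>\<open>L\<close> holds the output positions of \<open>J\<close>, so its
        complement takes the part of \<open>K\<close>.\<close>
      obtain L where L: "L \<subseteq> {1..s}" "J = (+) s ` L"
        using J(1) unfolding shift_atLeastAtMost by (rule subset_imageE)
      then have card: "card ({1..s} - L) = s - t"
        using J(2) finite_subset[OF L(1)] by (simp add: card_Diff_subset card_image)
      then have "card I + card ({1..s} - L) = s" using I(2) ts by simp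
      moreover have "?pairs I ({1..s} - L)"
        by (rule pairs[THEN spec, THEN spec, THEN mp]) (use I card in simp)
      ultimately show "unbiased (v ^ s) v X A (I \<union> ({s+1..2*s} - J))"
        unfolding L(2) outputs_complement
        using unbiased_graph_iff[OF arr graph I(1) Diff_subset] by (simp only:)
    qed
  qed
  show ?thesis
  \<comment> \<open>\<open>undetermined_iff\<close> is available only for bijective
    \<open>\<phi>\<close>. Otherwise both sides fail, the array by \<open>outputs\<close>.\<close>
  proof (cases "bij_betw \<phi> ?T ?T")
    case True
    have "?allpairs \<longleftrightarrow> (\<forall>K I. K \<subseteq> {1..s} \<and> card K = s - t \<and> I \<subseteq> {1..s} \<and> card I = t \<longrightarrow>
        (\<forall>b \<in> tuples K X. (\<lambda>y. restrict (inv_into ?T \<phi> y) I) `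
          {y \<in> ?T. restrict y K = b} = tuples I X))"
      by (intro iff_allI imp_cong refl undetermined_iff[OF True, symmetric]) (elim conjE)
    then show ?thesis
      unfolding aont_def aont_array_def outputs mixed_iff
      using ts X arr inputs True by (simp only: simp_thms)
  next
    case False
    then show ?thesis
      unfolding aont_def aont_array_def outputs by (simp only: simp_thms)
  qed
qed

section \<open>Constructing an array from a map and a map from an array\<close>

text \<open>There are \<open>v ^ s\<close> input tuples, so some \<open>g\<close> numbers them by
  the rows; row \<open>r\<close> is \<open>g r\<close> followed by
  \<open>\<phi> (g r)\<close>.\<close>

lemma ex_array_of_map:
  assumes "finite X" "card X = v"
    and \<phi>: "\<phi> \<in> tuples {1..s} X \<rightarrow> tuples {1..s} X"
  obtains A where "is_array (v ^ s) (2 * s) v X A" "lists_graph s v X A \<phi>"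
proof -
  let ?T = "tuples {1..s} X"
  have "card {1..v ^ s} = card ?T" using card_tuples[of "{1..s}" X] assms by simp
  then obtain g where g: "bij_betw g {1..v ^ s} ?T"
    using finite_same_card_bij[of "{1..v ^ s}" ?T] assms(1) by (auto simp: finite_PiE)
  then have gT: "g r \<in> ?T" if "r \<in> {1..v ^ s}" for r
    using that by (auto simp: bij_betw_def)
  define A where "A r c = (if c \<le> s then g r c else \<phi> (g r) (c - s))" for r c
  have gA: "restrict (A r) {1..s} = g r" if "r \<in> {1..v ^ s}" for r
    using gT[OF that] by (auto simp: A_def fun_eq_iff PiE_def extensional_def)
  show thesis
  proof
    show "is_array (v ^ s) (2 * s) v X A"
      unfolding is_array_def
    proof (intro conjI ballI)
      fix r c assume r: "r \<in> {1..v ^ s}" and c: "c \<in> {1..2 * s}"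
      show "A r c \<in> X"
      proof (cases "c \<le> s")
        case True
        then show ?thesis using PiE_mem[OF gT[OF r], of c] c by (simp add: A_def)
      next
        case False
        have "\<phi> (g r) \<in> ?T" using \<phi> gT[OF r] by blast
        moreover have "c - s \<in> {1..s}" using False c by auto
        ultimately have "\<phi> (g r) (c - s) \<in> X" by (rule PiE_mem)
        with False show ?thesis by (simp add: A_def)
      qed
    qed (use assms in auto)
    show "lists_graph s v X A \<phi>"
      unfolding lists_graph_def
    proof
      have "bij_betw (\<lambda>r. restrict (A r) {1..s}) {1..v ^ s} ?T \<longleftrightarrow> bij_betw g {1..v ^ s} ?T"
        by (rule bij_betw_cong) (rule gA)
      then show "bij_betw (\<lambda>r. restrict (A r) {1..s}) {1..v ^ s} ?T"
        using g by (rule iffD2)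
      show "\<forall>r\<in>{1..v ^ s}. \<forall>i\<in>{1..s}. A r (s + i) = \<phi> (restrict (A r) {1..s}) i"
        using gA by (auto simp: A_def)
    qed
  qed
qed

text \<open>Unbiasedness on the inputs makes each \<open>x\<close> the input half of exactly one
  row, whose output half is taken as \<open>\<phi> x\<close>.\<close>

lemma ex_map_of_array:
  assumes arr: "is_array (v ^ s) (2 * s) v X A" and "unbiased (v ^ s) v X A {1..s}"
  obtains \<phi> where "\<phi> \<in> tuples {1..s} X \<rightarrow> tuples {1..s} X" "lists_graph s v X A \<phi>"
proof -
  let ?x = "\<lambda>r. restrict (A r) {1..s}"
  have bij: "bij_betw ?x {1..v ^ s} (tuples {1..s} X)"
    using assms unbiased_iff_bij_betw[OF arr, of "{1..s}"] by simp
  define row where "row = inv_into {1..v ^ s} ?x"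
  \<comment> \<open>The restriction makes \<open>\<phi> x\<close> extensional, as membership in
    \<open>tuples {1..s} X\<close> demands.\<close>
  define \<phi> where "\<phi> x = restrict (\<lambda>i. A (row x) (s + i)) {1..s}" for x
  have row: "row x \<in> {1..v ^ s}" if "x \<in> tuples {1..s} X" for x
    unfolding row_def using bij that by (metis bij_betw_def inv_into_into)
  have row_x: "row (?x r) = r" if "r \<in> {1..v ^ s}" for r
    unfolding row_def using bij that by (intro inv_into_f_f) (auto simp: bij_betw_def)
  show thesis
  proof
    show "\<phi> \<in> tuples {1..s} X \<rightarrow> tuples {1..s} X"
      using row arr by (auto simp: \<phi>_def is_array_def)
    show "lists_graph s v X A \<phi>"
      using bij row_x by (auto simp: lists_graph_def \<phi>_def)
  qed
qed

theorem theorem6p1: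
  fixes t s v :: nat and X :: "'a set"
  assumes "1 \<le> t" and "t \<le> s" and "finite X" and "card X = v"
  shows "((\<exists>\<phi>. aont t s v X \<phi>) \<longleftrightarrow> (\<exists>A. aont_array t s v X A)) \<and>
    (\<forall>\<phi>. aont t s v X \<phi> \<longrightarrow> (\<exists>A. aont_array t s v X A \<and> lists_graph s v X A \<phi>)) \<and>
    (\<forall>A. aont_array t s v X A \<longrightarrow> (\<exists>\<phi>. aont t s v X \<phi> \<and> lists_graph s v X A \<phi>))"
proof -
  have "\<exists>A. aont_array t s v X A \<and> lists_graph s v X A \<phi>" if aont: "aont t s v X \<phi>" for \<phi>
  proof -
    have \<phi>: "\<phi> \<in> tuples {1..s} X \<rightarrow> tuples {1..s} X"
      using aont by (auto simp: aont_def bij_betw_def)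
    then show ?thesis
      using ex_array_of_map[OF assms(3,4)] aont_iff_aont_array[OF assms(1,2)] aont by metis
  qed
  moreover have "\<exists>\<phi>. aont t s v X \<phi> \<and> lists_graph s v X A \<phi>" if A: "aont_array t s v X A" for A
  proof -
    have arr: "is_array (v ^ s) (2 * s) v X A" and "unbiased (v ^ s) v X A {1..s}"
      using A by (auto simp: aont_array_def)
    then show ?thesis
      using ex_map_of_array aont_iff_aont_array[OF assms(1,2) arr] A by metis
  qed
  \<comment> \<open>The equivalence follows from the two refined implications by forgetting
    \<open>lists_graph\<close>.\<close>
  ultimately show ?thesis by blast
qed

end
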